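(* Let $(X,X_+,\mathcal{K},f)$ be an abstract state space and let $\{P_n\}_{n\ge1}$ be a left decreasing sequence of Markov projections of $X$. Let $\mathfrak{S}_{\{P_n\}}(X)$ be the set of all sequences $\mathcal{T}=\{T_n\}_{n=1}^\infty$ of Markov operators on $X$ with $T_nP_n=P_nT_n$ and $T_nP_n=P_n$ for all $n\in\mathbb{N}$, endowed with the metric $$d(\mathcal{T},\mathcal{S})=\sum_{n=1}^\infty\frac{\|T_n-S_n\|}{2^n},\qquad \mathcal{T}=\{T_n\},\ \mathcal{S}=\{S_n\}.$$ Let $\mathfrak{S}_{\{P_n\}}^w(X)$ be the set of those $\mathcal{T}\in\mathfrak{S}_{\{P_n\}}(X)$ for which the NDMC $\{T^{m,n}\}$ generated by $\mathcal{T}$ is weakly ergodic with respect to $\{P_n\}$. Then $\mathfrak{S}_{\{P_n\}}^w(X)$ is a dense $G_\delta$-subset of $\mathfrak{S}_{\{P_n\}}(X)$.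
   Context: Abstract state space: $X$ is a real ordered vector space with generating cone $X_+=\{x\in X: x\ge 0\}$ (i.e. $X=X_+-X_+$), $f$ is a strictly positive linear functional on $X$ ($f(x)>0$ for $x>0$), and $\mathcal{K}=\{x\in X_+: f(x)=1\}$. With $U$ the convex hull of $\mathcal{K}\cup(-\mathcal{K})$, put $\|x\|=\inf\{\lambda\in\mathbb{R}_+: x\in\lambda U\}$. $(X,X_+,\mathcal{K},f)$ is an abstract state space if $\|\cdot\|$ is a norm, $X$ is complete for it, and $X_+$ is closed. $X$ always carries this norm, and norms of operators are the induced operator norms. Markov operator: a linear $T:X\to X$ that is positive ($Tx\ge0$ whenever $x\ge0$) and satisfies $T(\mathcal{K})\subset\mathcal{K}$ (then $\|T\|=1$). Markov projection: a Markov operator $P$ with $P^2=P$. $\mathbb{N}=\{1,2,\dots\}$. The nonhomogeneous discrete Markov chain (NDMC) generated by $\{T_n\}_{n\ge1}$ is the family $T^{k,n}=T_nT_{n-1}\cdots T_{k+1}$, $k<n$. A sequence of projections $\{P_n\}$ is left decreasing if $P_{n+1}P_n=P_{n+1}$ for all $n\in\mathbb{N}$. Generalized Dobrushin ergodicity coefficient: for a bounded linear operator $T$ on $X$ and a non-trivial projection $P$ on $X$, let $N_P=\{x\in X: Px=0\}$ and $\delta_P(T)=\sup_{x\in N_P,\,x\ne0}\|Tx\|/\|x\|$; if $P=I$ (the identity), one puts $\delta_P(T)=1$. $\{T^{m,n}\}$ is weakly ergodic with respect to $\{P_n\}$ if $\lim_{n\to\infty}\delta_{P_{m+1}}(T^{m,n})=0$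 for every $m>0$.
   Formalization: The projections P_n with n ≥ 2 are assumed different from the identity; if some such P_n = I, then by the convention δ_I(T) = 1 no sequence is weakly ergodic, while {P_n} itself lies in the space, so the density claim fails. *)

theory Defs
  imports "HOL-Analysis.Analysis"
begin

definition base :: "('a::ordered_real_vector \<Rightarrow> real) \<Rightarrow> 'a set" where
  "base f = {x. 0 \<le> x \<and> f x = 1}"

definition unit_hull :: "('a::ordered_real_vector \<Rightarrow> real) \<Rightarrow> 'a set" where
  "unit_hull f = convex hull (base f \<union> uminus ` base f)"

(* The order of the type class is the one of X.  That the gauge of the unit hull is a norm, and
   that X is complete for it, is expressed by requiring the gauge to coincide with the norm of
   the class banach. *)
definition abstract_state_space :: "('a::{banach, ordered_real_vector} \<Rightarrow> real) \<Rightarrow> bool" where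
  "abstract_state_space f \<longleftrightarrow>
     (\<forall>x::'a. \<exists>y z. 0 \<le> y \<and> 0 \<le> z \<and> x = y - z) \<and>
     linear f \<and>
     (\<forall>x>0. f x > 0) \<and>
     (\<forall>x. norm x = Inf {l. 0 \<le> l \<and> x \<in> (\<lambda>u. l *\<^sub>R u) ` unit_hull f}) \<and>
     closed {x::'a. 0 \<le> x}"

definition markov_operator ::
  "('a::ordered_real_vector \<Rightarrow> real) \<Rightarrow> ('a \<Rightarrow> 'a) \<Rightarrow> bool" where
  "markov_operator f T \<longleftrightarrow> linear T \<and> (\<forall>x\<ge>0. 0 \<le> T x) \<and> T ` base f \<subseteq> base f"

definition markov_projection ::
  "('a::ordered_real_vector \<Rightarrow> real) \<Rightarrow> ('a \<Rightarrow> 'a) \<Rightarrow> bool" where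
  "markov_projection f P \<longleftrightarrow> markov_operator f P \<and> P \<circ> P = P"

(* All sequences below are indexed by 1, 2, ...; the value at index 0 plays no role. *)
definition left_decreasing :: "(nat \<Rightarrow> 'a \<Rightarrow> 'a) \<Rightarrow> bool" where
  "left_decreasing P \<longleftrightarrow> (\<forall>n\<ge>1. P (n + 1) \<circ> P n = P (n + 1))"

(* ndmc T k n = T n o ... o T (k + 1) for k < n, and the identity otherwise. *)
primrec ndmc :: "(nat \<Rightarrow> 'a \<Rightarrow> 'a) \<Rightarrow> nat \<Rightarrow> nat \<Rightarrow> 'a \<Rightarrow> 'a" where
  "ndmc T k 0 = id"
| "ndmc T k (Suc n) = (if k \<le> n then T (Suc n) \<circ> ndmc T k n else id)"

definition dobrushin ::
  "('a::real_normed_vector \<Rightarrow> 'a) \<Rightarrow> ('a \<Rightarrow> 'a) \<Rightarrow> real" where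
  "dobrushin P T =
     (if P = id then 1 else (SUP x\<in>{x. P x = 0 \<and> x \<noteq> 0}. norm (T x) / norm x))"

(* By the convention for the identity, no T is weakly ergodic with respect to P if P n = id for
   some n >= 2; hence the non-triviality of these projections has to be assumed for density. *)
definition weakly_ergodic ::
  "(nat \<Rightarrow> 'a::real_normed_vector \<Rightarrow> 'a) \<Rightarrow> (nat \<Rightarrow> 'a \<Rightarrow> 'a) \<Rightarrow> bool" where
  "weakly_ergodic P T \<longleftrightarrow>
     (\<forall>m>0. (\<lambda>n. dobrushin (P (m + 1)) (ndmc T m n)) \<longlonglongrightarrow> 0)"

(* Extensionality on {1..} fixes the irrelevant value at index 0, so that two members are equal
   iff they agree at all indices n >= 1. *)
definition markov_sequences ::
  "('a::ordered_real_vector \<Rightarrow> real) \<Rightarrow> (nat \<Rightarrow> 'a \<Rightarrow> 'a) \<Rightarrow> (nat \<Rightarrow> 'a \<Rightarrow> 'a) set" where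
  "markov_sequences f P =
     {T \<in> extensional {1..}.
        \<forall>n\<ge>1. markov_operator f (T n) \<and> T n \<circ> P n = P n \<circ> T n \<and> T n \<circ> P n = P n}"

definition weakly_ergodic_sequences ::
  "('a::{banach, ordered_real_vector} \<Rightarrow> real) \<Rightarrow> (nat \<Rightarrow> 'a \<Rightarrow> 'a) \<Rightarrow> (nat \<Rightarrow> 'a \<Rightarrow> 'a) set"
  where
  "weakly_ergodic_sequences f P = {T \<in> markov_sequences f P. weakly_ergodic P T}"

(* The value 0 off the carrier is needed only because the locale Metric_space requires
   nonnegativity and symmetry for all arguments. *)
definition seq_dist ::
  "('a::{banach, ordered_real_vector} \<Rightarrow> real) \<Rightarrow> (nat \<Rightarrow> 'a \<Rightarrow> 'a) \<Rightarrow>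
   (nat \<Rightarrow> 'a \<Rightarrow> 'a) \<Rightarrow> (nat \<Rightarrow> 'a \<Rightarrow> 'a) \<Rightarrow> real" where
  "seq_dist f P T S =
     (if T \<in> markov_sequences f P \<and> S \<in> markov_sequences f P
      then (\<Sum>n. onorm (\<lambda>x. T (Suc n) x - S (Suc n) x) / 2 ^ Suc n) else 0)"

abbreviation seq_topology ::
  "('a::{banach, ordered_real_vector} \<Rightarrow> real) \<Rightarrow> (nat \<Rightarrow> 'a \<Rightarrow> 'a) \<Rightarrow>
   (nat \<Rightarrow> 'a \<Rightarrow> 'a) topology" where
  "seq_topology f P \<equiv> Metric_space.mtopology (markov_sequences f P) (seq_dist f P)"

lemma gauge_set_nonempty:
  assumes A: "abstract_state_space f" and "x \<noteq> 0"
  shows "\<exists>l\<ge>0. x \<in> (\<lambda>u. l *\<^sub>R u) ` unit_hull f"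
proof -
  have lin: "linear f" and pos: "\<And>x. x > 0 \<Longrightarrow> f x > 0"
    using A by (auto simp: abstract_state_space_def)
  obtain y z where yz: "0 \<le> y" "0 \<le> z" "x = y - z"
    using A unfolding abstract_state_space_def by metis
  have conv: "convex (unit_hull f)" by (simp add: unit_hull_def)
  have nb: "(1 / f w) *\<^sub>R w \<in> base f" if "w > 0" for w
    using that pos[OF that] lin by (auto simp: base_def linear_scale intro!: scaleR_nonneg_nonneg)
  have U1: "(1 / f w) *\<^sub>R w \<in> unit_hull f" "- ((1 / f w) *\<^sub>R w) \<in> unit_hull f" if "w > 0" for w
    using nb[OF that] unfolding unit_hull_def by (auto intro!: hull_inc)
  consider "y = 0" "z > 0" | "y > 0" "z = 0" | "y > 0" "z > 0"
    using yz \<open>x \<noteq> 0\<close> by fastforce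
  then show ?thesis
  proof cases
    case 1
    have "x = f z *\<^sub>R (- ((1 / f z) *\<^sub>R z))" using 1 pos[of z] yz by simp
    then show ?thesis
      using imageI[OF U1(2), of z "\<lambda>u. f z *\<^sub>R u"] 1 pos[of z] by (metis less_imp_le)
  next
    case 2
    have "x = f y *\<^sub>R ((1 / f y) *\<^sub>R y)" using 2 pos[of y] yz by simp
    then show ?thesis
      using imageI[OF U1(1), of y "\<lambda>u. f y *\<^sub>R u"] 2 pos[of y] by (metis less_imp_le)
  next
    case 3
    let ?l = "f y + f z"
    let ?u = "(f y / ?l) *\<^sub>R ((1 / f y) *\<^sub>R y) + (f z / ?l) *\<^sub>R (- ((1 / f z) *\<^sub>R z))"
    have l: "f y > 0" "f z > 0" "?l > 0" using 3 pos[of y] pos[of z] by auto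
    have "?u \<in> unit_hull f"
      using l by (intro convexD[OF conv] U1 3) (auto simp: add_divide_distrib[symmetric])
    moreover have "x = ?l *\<^sub>R ?u"
      using l yz by (simp add: scaleR_right_diff_distrib)
    ultimately show ?thesis using l by (intro exI[of _ ?l]) auto
  qed
qed

lemma markov_operator_norm_le:
  assumes A: "abstract_state_space f" and T: "markov_operator f T"
  shows "norm (T x) \<le> norm x"
proof (cases "x = 0")
  case True
  then show ?thesis using T by (simp add: markov_operator_def linear_0)
next
  case False
  have lin: "linear T" and TB: "T ` base f \<subseteq> base f" using T by (auto simp: markov_operator_def)
  have "T ` (base f \<union> uminus ` base f) \<subseteq> base f \<union> uminus ` base f"
    using TB lin by (auto simp: linear_neg)
  then have TU: "T ` unit_hull f \<subseteq> unit_hull f"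
    unfolding unit_hull_def by (metis convex_hull_linear_image[OF lin] hull_mono)
  let ?G = "\<lambda>x. {l. 0 \<le> l \<and> x \<in> (\<lambda>u. l *\<^sub>R u) ` unit_hull f}"
  have nrm: "norm y = Inf (?G y)" for y using A unfolding abstract_state_space_def by blast
  have "?G x \<subseteq> ?G (T x)" using TU lin by (auto simp: linear_scale intro!: imageI)
  moreover have "?G x \<noteq> {}" using gauge_set_nonempty[OF A False] by blast
  ultimately show ?thesis
    unfolding nrm by (intro cInf_superset_mono) (auto intro: bdd_belowI[of _ 0])
qed

lemma markov_operator_bounded_linear:
  assumes "abstract_state_space f" "markov_operator f T"
  shows "bounded_linear T"
  using assms markov_operator_norm_le[OF assms]
  by (auto simp: markov_operator_def linear_iff intro!: bounded_linear_intro[of T 1])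

lemma Metric_space_markov_sequences:
  assumes A: "abstract_state_space f"
  shows "Metric_space (markov_sequences f P) (seq_dist f P)"
proof -
  let ?M = "markov_sequences f P"
  let ?o = "\<lambda>T S n. onorm (\<lambda>x. T (Suc n) x - S (Suc n) x)"
  have bl: "bounded_linear (T (Suc n))" and nle: "norm (T (Suc n) x) \<le> norm x"
    if "T \<in> ?M" for T n x
    using that markov_operator_bounded_linear[OF A] markov_operator_norm_le[OF A]
    by (auto simp: markov_sequences_def)
  have bls: "bounded_linear (\<lambda>x. T (Suc n) x - S (Suc n) x)" if "T \<in> ?M" "S \<in> ?M" for T S n
    using that by (intro bounded_linear_sub bl)
  have o0: "0 \<le> ?o T S n" if "T \<in> ?M" "S \<in> ?M" for T S n
    by (rule onorm_pos_le[OF bls[OF that]])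
  have o2: "?o T S n \<le> 2" if "T \<in> ?M" "S \<in> ?M" for T S n
  proof (rule onorm_bound)
    fix x
    show "norm (T (Suc n) x - S (Suc n) x) \<le> 2 * norm x"
      using norm_triangle_ineq4[of "T (Suc n) x" "S (Suc n) x"] nle[OF that(1), of n x]
        nle[OF that(2), of n x] by linarith
  qed simp
  have sm: "summable (\<lambda>n. ?o T S n / 2 ^ Suc n)" if "T \<in> ?M" "S \<in> ?M" for T S
  proof (rule summable_comparison_test')
    show "summable (\<lambda>n. (1/2::real) ^ n)" by (simp add: summable_geometric)
    fix n :: nat
    show "norm (?o T S n / 2 ^ Suc n) \<le> (1/2) ^ n"
      using o0[OF that, of n] o2[OF that, of n] by (simp add: field_simps)
  qed
  have ocomm: "?o T S n = ?o S T n" for T S :: "nat \<Rightarrow> 'a \<Rightarrow> 'a" and n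
    unfolding onorm_def by (simp add: norm_minus_commute)
  show ?thesis
  proof
    fix T S
    show "0 \<le> seq_dist f P T S"
      unfolding seq_dist_def using o0 sm by (auto intro!: suminf_nonneg)
    show "seq_dist f P T S = seq_dist f P S T"
      unfolding seq_dist_def using ocomm by auto
  next
    fix T S assume M: "T \<in> ?M" "S \<in> ?M"
    show "seq_dist f P T S = 0 \<longleftrightarrow> T = S"
    proof
      assume "seq_dist f P T S = 0"
      then have "\<forall>n. ?o T S n / 2 ^ Suc n = 0"
        using M suminf_eq_zero_iff[OF sm[OF M]] o0[OF M] by (simp add: seq_dist_def)
      then have "T (Suc n) x = S (Suc n) x" for n x
        using onorm_eq_0[OF bls[OF M]] by auto
      then have "T n = S n" if "n \<in> {1..}" for n
        using that by (cases n) auto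
      then show "T = S"
        using M by (intro extensionalityI[of _ "{1..}"]) (auto simp: markov_sequences_def)
    next
      assume "T = S"
      then show "seq_dist f P T S = 0" by (simp add: seq_dist_def onorm_zero)
    qed
  next
    fix T S R assume M: "T \<in> ?M" "S \<in> ?M" "R \<in> ?M"
    have tri: "?o T R n / 2 ^ Suc n \<le> ?o T S n / 2 ^ Suc n + ?o S R n / 2 ^ Suc n" for n
    proof -
      have "?o T R n = onorm (\<lambda>x. (T (Suc n) x - S (Suc n) x) + (S (Suc n) x - R (Suc n) x))"
        by simp
      also have "\<dots> \<le> ?o T S n + ?o S R n" using M by (intro onorm_triangle bls)
      finally show ?thesis by (simp add: add_divide_distrib[symmetric] divide_right_mono)
    qed
    have "(\<Sum>n. ?o T R n / 2 ^ Suc n) \<le> (\<Sum>n. ?o T S n / 2 ^ Suc n + ?o S R n / 2 ^ Suc n)"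
      using M by (intro suminf_le tri sm summable_add)
    also have "\<dots> = (\<Sum>n. ?o T S n / 2 ^ Suc n) + (\<Sum>n. ?o S R n / 2 ^ Suc n)"
      using M by (intro suminf_add[symmetric] sm)
    finally show "seq_dist f P T R \<le> seq_dist f P T S + seq_dist f P S R"
      using M by (simp add: seq_dist_def)
  qed
qed

end

theory Submission
  imports Defs
begin

text \<open>
  Markov operators are contractions for the norm of the state space, so along every chain the
  coefficients \<open>\<delta>(T\<^sup>m\<^sup>,\<^sup>n)\<close> are nonincreasing in \<open>n\<close>. Convergence to \<open>0\<close> therefore only asks that,
  for every \<open>m\<close> and \<open>k\<close>, some coefficient falls below \<open>1 / (k + 1)\<close>
  (\<open>weakly_ergodic_iff_dobrushin_small\<close>). For fixed \<open>m\<close>, \<open>n\<close> the coefficient depends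
  only on the finitely many operators \<open>T\<^bsub>m+1\<^esub>, \<dots>, T\<^bsub>n\<^esub>\<close> and is a Lipschitz function of the sequence
  (\<open>dobrushin_ndmc_lipschitz\<close>); so each of these conditions is a union of open ones, and the weakly
  ergodic sequences form a countable intersection of open sets.

  For density, a given sequence is perturbed to \<open>S\<^bsub>n\<^esub> = (1 - \<epsilon>) T\<^bsub>n\<^esub> + \<epsilon> P\<^bsub>n\<^esub>\<close>, which lies within
  \<open>2 \<epsilon>\<close> of it. On the kernel of \<open>P\<^bsub>n\<^esub>\<close> the operator \<open>S\<^bsub>n\<^esub>\<close> is \<open>(1 - \<epsilon>) T\<^bsub>n\<^esub>\<close>. Commutation makes this
  kernel invariant, and left decrease makes it grow with \<open>n\<close>; a vector starting in the kernel
  of \<open>P\<^bsub>m+1\<^esub>\<close> hence shrinks by the factor \<open>1 - \<epsilon>\<close> at every step, and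
  \<open>\<delta>(S\<^sup>m\<^sup>,\<^sup>n) \<le> (1 - \<epsilon>)\<^bsup>n-m\<^esup>\<close> tends to \<open>0\<close>.
\<close>

section \<open>The Dobrushin coefficient\<close>

text \<open>
  A projection \<open>P \<noteq> id\<close> kills every \<open>x - P x\<close>. The point is that the supremum in the Dobrushin
  coefficient then ranges over a nonempty set, so that it is characterised by its upper bounds.
\<close>
lemma exists_nonzero_kernel:
  fixes P :: "'a::real_vector \<Rightarrow> 'a"
  assumes "linear P" "P \<circ> P = P" "P \<noteq> id"
  shows "\<exists>x. P x = 0 \<and> x \<noteq> 0"
proof -
  obtain x where "P x \<noteq> x" using assms(3) by (auto simp: fun_eq_iff)
  moreover have "P (x - P x) = 0"
    using assms(1,2) by (simp add: linear_diff fun_eq_iff)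
  ultimately show ?thesis by (intro exI[of _ "x - P x"]) auto
qed

lemma dobrushin_le_iff:
  fixes P T :: "'a::real_normed_vector \<Rightarrow> 'a"
  assumes P: "linear P" "P \<circ> P = P" "P \<noteq> id" and T: "bounded_linear T"
  shows "dobrushin P T \<le> c \<longleftrightarrow> (\<forall>x. P x = 0 \<longrightarrow> norm (T x) \<le> c * norm x)"
proof -
  let ?A = "{x. P x = 0 \<and> x \<noteq> 0}"
  have "?A \<noteq> {}" using exists_nonzero_kernel[OF P] by auto
  moreover have "bdd_above ((\<lambda>x. norm (T x) / norm x) ` ?A)"
    by (rule bdd_aboveI2[where M = "onorm T"]) (rule le_onorm[OF T])
  ultimately have "dobrushin P T \<le> c \<longleftrightarrow> (\<forall>x\<in>?A. norm (T x) / norm x \<le> c)"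
    using P(3) by (simp add: dobrushin_def cSUP_le_iff)
  also have "\<dots> \<longleftrightarrow> (\<forall>x. P x = 0 \<longrightarrow> norm (T x) \<le> c * norm x)"
    using linear_0[OF bounded_linear.linear[OF T]] by (force simp: divide_le_eq)
  finally show ?thesis .
qed

lemma dobrushin_nonneg:
  fixes P T :: "'a::real_normed_vector \<Rightarrow> 'a"
  assumes P: "linear P" "P \<circ> P = P" "P \<noteq> id" and T: "bounded_linear T"
  shows "0 \<le> dobrushin P T"
proof -
  obtain x where x: "P x = 0" "x \<noteq> 0" using exists_nonzero_kernel[OF P] by auto
  have "0 \<le> norm (T x)" by simp
  also have "\<dots> \<le> dobrushin P T * norm x"
    using dobrushin_le_iff[OF P T, of "dobrushin P T"] x by simp
  finally show ?thesis using x by (simp add: zero_le_mult_iff)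
qed

lemma dobrushin_mono:
  fixes P S T :: "'a::real_normed_vector \<Rightarrow> 'a"
  assumes P: "linear P" "P \<circ> P = P" "P \<noteq> id" and S: "bounded_linear S" and T: "bounded_linear T"
    and le: "\<And>x. norm (S x) \<le> norm (T x)"
  shows "dobrushin P S \<le> dobrushin P T"
  using dobrushin_le_iff[OF P S, of "dobrushin P T"] dobrushin_le_iff[OF P T, of "dobrushin P T"] le
  by (meson order_refl order_trans)

lemma dobrushin_perturb:
  fixes P S T :: "'a::real_normed_vector \<Rightarrow> 'a"
  assumes P: "linear P" "P \<circ> P = P" "P \<noteq> id" and S: "bounded_linear S" and T: "bounded_linear T"
    and le: "\<And>x. norm (S x - T x) \<le> c * norm x"
  shows "dobrushin P S \<le> dobrushin P T + c"
proof -
  have "norm (S x) \<le> (dobrushin P T + c) * norm x" if "P x = 0" for x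
  proof -
    have "norm (S x) \<le> norm (T x) + norm (S x - T x)" by (metis add.commute norm_triangle_sub)
    also have "norm (T x) \<le> dobrushin P T * norm x"
      using dobrushin_le_iff[OF P T, of "dobrushin P T"] that by simp
    finally show ?thesis using le[of x] by (simp add: algebra_simps)
  qed
  then show ?thesis by (simp add: dobrushin_le_iff[OF P S])
qed

section \<open>Chains of Markov operators\<close>

lemma markov_operator_compose:
  assumes "markov_operator f S" "markov_operator f T"
  shows "markov_operator f (S \<circ> T)"
  using assms by (fastforce simp: markov_operator_def linear_compose)

lemma markov_operator_id: "markov_operator f id"
  by (auto simp: markov_operator_def intro!: linear_id)

lemma markov_operator_convex_combination:
  assumes f: "linear f" and S: "markov_operator f S" and T: "markov_operator f T"
    and e: "0 \<le> e" "e \<le> 1"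
  shows "markov_operator f (\<lambda>x. (1 - e) *\<^sub>R S x + e *\<^sub>R T x)"
  unfolding markov_operator_def
proof (intro conjI allI impI)
  show "linear (\<lambda>x. (1 - e) *\<^sub>R S x + e *\<^sub>R T x)"
    using S T by (intro linear_compose_add linear_compose_scale_right) (auto simp: markov_operator_def)
  show pos: "0 \<le> (1 - e) *\<^sub>R S x + e *\<^sub>R T x" if "0 \<le> x" for x
    using S T e that by (auto simp: markov_operator_def intro!: add_nonneg_nonneg scaleR_nonneg_nonneg)
  show "(\<lambda>x. (1 - e) *\<^sub>R S x + e *\<^sub>R T x) ` base f \<subseteq> base f"
  proof clarify
    fix x assume x: "x \<in> base f"
    then have "f (S x) = 1" "f (T x) = 1" "0 \<le> x"
      using S T by (auto simp: markov_operator_def base_def)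
    then show "(1 - e) *\<^sub>R S x + e *\<^sub>R T x \<in> base f"
      using pos[of x] f by (simp add: base_def linear_add linear_scale)
  qed
qed

lemma ndmc_trivial: "n \<le> m \<Longrightarrow> ndmc T m n = id"
  by (cases n) auto

lemma markov_operator_ndmc:
  assumes "\<And>n. n \<ge> 1 \<Longrightarrow> markov_operator f (T n)"
  shows "markov_operator f (ndmc T m n)"
  using assms by (induction n) (auto simp: markov_operator_id intro!: markov_operator_compose)

lemma norm_ndmc_Suc_le:
  assumes "abstract_state_space f" "\<And>n. n \<ge> 1 \<Longrightarrow> markov_operator f (T n)"
  shows "norm (ndmc T m (Suc n) x) \<le> norm (ndmc T m n x)"
  using markov_operator_norm_le[OF assms(1) assms(2)] by (auto simp: ndmc_trivial)

section \<open>The metric on sequences of Markov operators\<close>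

lemma onorm_markov_diff_le:
  assumes A: "abstract_state_space f" and S: "markov_operator f S" and T: "markov_operator f T"
  shows "onorm (\<lambda>x. S x - T x) \<le> 2"
proof (rule onorm_bound)
  fix x
  show "norm (S x - T x) \<le> 2 * norm x"
    using norm_triangle_ineq4[of "S x" "T x"] markov_operator_norm_le[OF A S, of x]
      markov_operator_norm_le[OF A T, of x] by linarith
qed simp

lemma bounded_linear_markov_diff:
  assumes "abstract_state_space f" "markov_operator f S" "markov_operator f T"
  shows "bounded_linear (\<lambda>x. S x - T x)"
  using assms markov_operator_bounded_linear by (intro bounded_linear_sub)

lemma summable_seq_dist:
  assumes A: "abstract_state_space f" and M: "T \<in> markov_sequences f P" "S \<in> markov_sequences f P"
  shows "summable (\<lambda>n. onorm (\<lambda>x. T (Suc n) x - S (Suc n) x) / 2 ^ Suc n)"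
proof (rule summable_comparison_test')
  show "summable (\<lambda>n. (1/2::real) ^ n)" by (simp add: summable_geometric)
  fix n :: nat
  have m: "markov_operator f (T (Suc n))" "markov_operator f (S (Suc n))"
    using M by (auto simp: markov_sequences_def)
  show "norm (onorm (\<lambda>x. T (Suc n) x - S (Suc n) x) / 2 ^ Suc n) \<le> (1/2) ^ n"
    using onorm_markov_diff_le[OF A m] onorm_pos_le[OF bounded_linear_markov_diff[OF A m]]
    by (simp add: field_simps)
qed

lemma norm_diff_le_seq_dist:
  assumes A: "abstract_state_space f" and M: "T \<in> markov_sequences f P" "S \<in> markov_sequences f P"
  shows "norm (T (Suc n) x - S (Suc n) x) \<le> 2 ^ Suc n * seq_dist f P T S * norm x"
proof -
  let ?o = "\<lambda>n. onorm (\<lambda>x. T (Suc n) x - S (Suc n) x)"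
  have bl: "bounded_linear (\<lambda>x. T (Suc n) x - S (Suc n) x)" for n
    using M by (intro bounded_linear_markov_diff[OF A]) (auto simp: markov_sequences_def)
  have "(\<Sum>i\<in>{n}. ?o i / 2 ^ Suc i) \<le> (\<Sum>i. ?o i / 2 ^ Suc i)"
    by (intro sum_le_suminf summable_seq_dist[OF A M]) (auto intro!: divide_nonneg_pos onorm_pos_le bl)
  then have "?o n \<le> 2 ^ Suc n * seq_dist f P T S"
    using M by (simp add: seq_dist_def field_simps)
  then show ?thesis
    using onorm[OF bl, of n x] by (meson mult_right_mono norm_ge_zero order_trans)
qed

lemma seq_dist_le:
  assumes A: "abstract_state_space f" and M: "T \<in> markov_sequences f P" "S \<in> markov_sequences f P"
    and le: "\<And>n. n \<ge> 1 \<Longrightarrow> onorm (\<lambda>x. T n x - S n x) \<le> c"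
  shows "seq_dist f P T S \<le> c"
proof -
  have s: "(\<lambda>n. c / 2 ^ Suc n) sums c"
    using sums_mult[OF power_half_series, of c] by (simp add: power_one_over)
  have "(\<Sum>n. onorm (\<lambda>x. T (Suc n) x - S (Suc n) x) / 2 ^ Suc n) \<le> (\<Sum>n. c / 2 ^ Suc n)"
    by (intro suminf_le summable_seq_dist[OF A M] sums_summable[OF s] divide_right_mono le) auto
  then show ?thesis using M sums_unique[OF s] by (simp add: seq_dist_def)
qed

text \<open>
  Contractivity lets the errors of the factors add up, and the \<open>i\<close>-th factor contributes at most
  \<open>2\<^sup>i\<close> times the distance because of its weight in the metric; the sum of these powers up to \<open>n\<close> is
  below \<open>2\<^bsup>n+1\<^esup>\<close>.
\<close>
lemma norm_ndmc_diff_le: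
  assumes A: "abstract_state_space f" and M: "T \<in> markov_sequences f P" "S \<in> markov_sequences f P"
  shows "norm (ndmc T m n x - ndmc S m n x) \<le> 2 ^ Suc n * seq_dist f P T S * norm x"
proof -
  have d: "0 \<le> seq_dist f P T S"
    using Metric_space.nonneg[OF Metric_space_markov_sequences[OF A]] .
  have mk: "markov_operator f (T n)" "markov_operator f (S n)" if "n \<ge> 1" for n
    using M that by (auto simp: markov_sequences_def)
  show ?thesis
  proof (induction n)
    case 0
    show ?case using d by simp
  next
    case (Suc n)
    let ?C = "2 ^ Suc n * seq_dist f P T S * norm x"
    show ?case
    proof (cases "m \<le> n")
      case True
      let ?u = "ndmc T m n x" and ?v = "ndmc S m n x"
      have "linear (T (Suc n))" using mk(1)[of "Suc n"] by (simp add: markov_operator_def)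
      then have "T (Suc n) ?u - S (Suc n) ?v = T (Suc n) (?u - ?v) + (T (Suc n) ?v - S (Suc n) ?v)"
        by (simp add: linear_diff)
      then have "norm (T (Suc n) ?u - S (Suc n) ?v)
          \<le> norm (T (Suc n) (?u - ?v)) + norm (T (Suc n) ?v - S (Suc n) ?v)"
        by (metis norm_triangle_ineq)
      also have "norm (T (Suc n) (?u - ?v)) \<le> ?C"
        using markov_operator_norm_le[OF A mk(1), of "Suc n" "?u - ?v"] Suc by simp
      also have "norm (T (Suc n) ?v - S (Suc n) ?v) \<le> ?C"
      proof -
        have "norm ?v \<le> norm x"
          by (intro markov_operator_norm_le[OF A] markov_operator_ndmc mk)
        then have "2 ^ Suc n * seq_dist f P T S * norm ?v \<le> ?C"
          using d by (intro mult_left_mono) auto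
        then show ?thesis using norm_diff_le_seq_dist[OF A M, of n ?v] by linarith
      qed
      finally show ?thesis using True by (simp add: algebra_simps)
    next
      case False
      then show ?thesis using d by simp
    qed
  qed
qed

lemma dobrushin_ndmc_lipschitz:
  assumes A: "abstract_state_space f" and M: "T \<in> markov_sequences f P" "S \<in> markov_sequences f P"
    and Q: "linear Q" "Q \<circ> Q = Q" "Q \<noteq> id"
  shows "dobrushin Q (ndmc S m n) \<le> dobrushin Q (ndmc T m n) + 2 ^ Suc n * seq_dist f P T S"
proof (rule dobrushin_perturb[OF Q])
  show "bounded_linear (ndmc S m n)" "bounded_linear (ndmc T m n)"
    using M by (auto intro!: markov_operator_bounded_linear[OF A] markov_operator_ndmc
        simp: markov_sequences_def)
  show "norm (ndmc S m n x - ndmc T m n x) \<le> 2 ^ Suc n * seq_dist f P T S * norm x" for x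
    using norm_ndmc_diff_le[OF A M] by (simp add: norm_minus_commute)
qed

lemma openin_dobrushin_less:
  assumes A: "abstract_state_space f" and Q: "linear Q" "Q \<circ> Q = Q" "Q \<noteq> id"
  shows "openin (seq_topology f P) {T \<in> markov_sequences f P. dobrushin Q (ndmc T m n) < c}"
proof -
  interpret Metric_space "markov_sequences f P" "seq_dist f P"
    by (rule Metric_space_markov_sequences[OF A])
  show ?thesis
    unfolding openin_mtopology
  proof (intro conjI allI impI)
    fix T assume T: "T \<in> {T \<in> markov_sequences f P. dobrushin Q (ndmc T m n) < c}"
    let ?r = "(c - dobrushin Q (ndmc T m n)) / 2 ^ Suc n"
    have "mball T ?r \<subseteq> {T \<in> markov_sequences f P. dobrushin Q (ndmc T m n) < c}"
    proof
      fix S assume S: "S \<in> mball T ?r"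
      then have "2 ^ Suc n * seq_dist f P T S < c - dobrushin Q (ndmc T m n)"
        by (simp add: field_simps)
      then show "S \<in> {T \<in> markov_sequences f P. dobrushin Q (ndmc T m n) < c}"
        using dobrushin_ndmc_lipschitz[OF A _ _ Q, of T P S m n] S by simp
    qed
    then show "\<exists>r>0. mball T r \<subseteq> {T \<in> markov_sequences f P. dobrushin Q (ndmc T m n) < c}"
      using T by (intro exI[of _ ?r]) auto
  qed auto
qed

section \<open>Weak ergodicity\<close>

text \<open>
  A nonincreasing sequence of nonnegative numbers tends to \<open>0\<close> as soon as it has arbitrarily small
  members; this replaces the quantifier over all large \<open>n\<close> in the limit, which would put an
  intersection inside the union, by a purely existential one.
\<close>
lemma weakly_ergodic_iff_dobrushin_small:
  assumes A: "abstract_state_space f" and T: "\<And>n. n \<ge> 1 \<Longrightarrow> markov_operator f (T n)"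
    and P: "\<And>n. n \<ge> 2 \<Longrightarrow> linear (P n) \<and> P n \<circ> P n = P n \<and> P n \<noteq> id"
  shows "weakly_ergodic P T \<longleftrightarrow>
    (\<forall>m>0. \<forall>k. \<exists>n. dobrushin (P (m + 1)) (ndmc T m n) < 1 / real (Suc k))"
proof -
  have bl: "bounded_linear (ndmc T m n)" for m n
    by (intro markov_operator_bounded_linear[OF A] markov_operator_ndmc T)
  have "(\<lambda>n. dobrushin (P (m + 1)) (ndmc T m n)) \<longlonglongrightarrow> 0 \<longleftrightarrow>
      (\<forall>k. \<exists>n. dobrushin (P (m + 1)) (ndmc T m n) < 1 / real (Suc k))" (is "?\<delta> \<longlonglongrightarrow> 0 \<longleftrightarrow> ?R")
    if "m > 0" for m
  proof
    have Q: "linear (P (m + 1))" "P (m + 1) \<circ> P (m + 1) = P (m + 1)" "P (m + 1) \<noteq> id"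
      using P[of "m + 1"] that by auto
    have dec: "decseq ?\<delta>"
      by (intro decseq_SucI dobrushin_mono[OF Q bl bl] norm_ndmc_Suc_le[OF A T])
    have nn: "0 \<le> ?\<delta> n" for n by (rule dobrushin_nonneg[OF Q bl])
    show ?R if "?\<delta> \<longlonglongrightarrow> 0"
    proof
      fix k
      have "eventually (\<lambda>n. ?\<delta> n < 1 / real (Suc k)) sequentially"
        by (rule order_tendstoD(2)[OF that]) simp
      then show "\<exists>n. ?\<delta> n < 1 / real (Suc k)" by (auto simp: eventually_sequentially)
    qed
    show "?\<delta> \<longlonglongrightarrow> 0" if R: ?R
    proof (rule LIMSEQ_I)
      fix r :: real assume "0 < r"
      then obtain k where k: "1 / real (Suc k) < r" using nat_approx_posE by blast
      obtain N where N: "?\<delta> N < 1 / real (Suc k)" using R by blast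
      have "norm (?\<delta> n - 0) < r" if "n \<ge> N" for n
        using decseqD[OF dec that] nn[of n] N k by simp
      then show "\<exists>N. \<forall>n\<ge>N. norm (?\<delta> n - 0) < r" by blast
    qed
  qed
  then show ?thesis unfolding weakly_ergodic_def by blast
qed

text \<open>
  The invariant of the induction is that the orbit of \<open>x\<close> stays in the growing kernels, which is
  what makes each further contraction applicable.
\<close>
lemma ndmc_contracts_kernel:
  fixes P S :: "nat \<Rightarrow> 'a::real_normed_vector \<Rightarrow> 'a"
  assumes linP: "\<And>n. n \<ge> 1 \<Longrightarrow> linear (P n)" and linS: "\<And>n. n \<ge> 1 \<Longrightarrow> linear (S n)"
    and ld: "left_decreasing P"
    and comm: "\<And>n. n \<ge> 1 \<Longrightarrow> S n \<circ> P n = P n \<circ> S n"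
    and contr: "\<And>n x. n \<ge> 1 \<Longrightarrow> P n x = 0 \<Longrightarrow> norm (S n x) \<le> q * norm x"
    and q: "0 \<le> q" and x: "P (Suc m) x = 0"
  shows "P (Suc (m + j)) (ndmc S m (m + j) x) = 0 \<and> norm (ndmc S m (m + j) x) \<le> q ^ j * norm x"
proof (induction j)
  case 0
  then show ?case using x by (simp add: ndmc_trivial)
next
  case (Suc j)
  let ?n = "Suc (m + j)" and ?y = "ndmc S m (m + j) x"
  have y: "P ?n ?y = 0" and ny: "norm ?y \<le> q ^ j * norm x" using Suc by auto
  have "P ?n (S ?n ?y) = S ?n (P ?n ?y)" using comm[of ?n] by (simp add: fun_eq_iff)
  also have "\<dots> = 0" using y linS[of ?n] by (simp add: linear_0)
  finally have 0: "P ?n (S ?n ?y) = 0" .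
  have "P (Suc ?n) (S ?n ?y) = P (Suc ?n) (P ?n (S ?n ?y))"
    using ld by (auto simp: left_decreasing_def fun_eq_iff dest!: spec[of _ ?n])
  then have "P (Suc ?n) (S ?n ?y) = 0" using 0 linP[of "Suc ?n"] by (simp add: linear_0)
  moreover have "norm (S ?n ?y) \<le> q ^ Suc j * norm x"
  proof -
    have "norm (S ?n ?y) \<le> q * norm ?y" using contr[of ?n ?y] y by simp
    also have "\<dots> \<le> q * (q ^ j * norm x)" using ny q by (rule mult_left_mono)
    finally show ?thesis by (simp add: mult.assoc)
  qed
  ultimately show ?case by simp
qed

definition perturbed ::
  "real \<Rightarrow> (nat \<Rightarrow> 'a::real_vector \<Rightarrow> 'a) \<Rightarrow> (nat \<Rightarrow> 'a \<Rightarrow> 'a) \<Rightarrow> nat \<Rightarrow> 'a \<Rightarrow> 'a" where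
  "perturbed e P T = restrict (\<lambda>n x. (1 - e) *\<^sub>R T n x + e *\<^sub>R P n x) {1..}"

lemma perturbed_in_markov_sequences:
  assumes A: "abstract_state_space f" and P: "\<And>n. n \<ge> 1 \<Longrightarrow> markov_projection f (P n)"
    and T: "T \<in> markov_sequences f P" and e: "0 \<le> e" "e \<le> 1"
  shows "perturbed e P T \<in> markov_sequences f P"
  unfolding markov_sequences_def
proof (intro CollectI conjI allI impI)
  show "perturbed e P T \<in> extensional {1..}" by (simp add: perturbed_def)
  fix n :: nat assume n: "1 \<le> n"
  have S: "perturbed e P T n = (\<lambda>x. (1 - e) *\<^sub>R T n x + e *\<^sub>R P n x)"
    using n by (simp add: perturbed_def)
  have Tn: "markov_operator f (T n)" and TP: "T n (P n x) = P n x" and PT: "P n (T n x) = P n x" for x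
    using T n by (auto simp: markov_sequences_def fun_eq_iff)
  have Pn: "markov_operator f (P n)" and PP: "P n (P n x) = P n x" for x
    using P[OF n] by (auto simp: markov_projection_def fun_eq_iff)
  have linP: "linear (P n)" using Pn by (simp add: markov_operator_def)
  have "linear f" using A by (simp add: abstract_state_space_def)
  then show "markov_operator f (perturbed e P T n)"
    unfolding S using Tn Pn e by (rule markov_operator_convex_combination)
  show SP: "perturbed e P T n \<circ> P n = P n"
    by (simp add: S fun_eq_iff TP PP flip: scaleR_left_distrib)
  show "perturbed e P T n \<circ> P n = P n \<circ> perturbed e P T n"
    unfolding SP by (simp add: S fun_eq_iff linear_add[OF linP] linear_scale[OF linP] PT PP
        flip: scaleR_left_distrib)
qed

lemma weakly_ergodic_perturbed:
  assumes A: "abstract_state_space f" and P: "\<And>n. n \<ge> 1 \<Longrightarrow> markov_projection f (P n)"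
    and ld: "left_decreasing P" and nontriv: "\<And>n. n \<ge> 2 \<Longrightarrow> P n \<noteq> id"
    and T: "T \<in> markov_sequences f P" and e: "0 < e" "e \<le> 1"
  shows "weakly_ergodic P (perturbed e P T)"
  unfolding weakly_ergodic_def
proof (intro allI impI)
  let ?S = "perturbed e P T"
  have SM: "?S \<in> markov_sequences f P"
    using e by (intro perturbed_in_markov_sequences[OF A P T]) auto
  have mkS: "markov_operator f (?S n)" and comm: "?S n \<circ> P n = P n \<circ> ?S n" if "n \<ge> 1" for n
    using SM that unfolding markov_sequences_def by blast+
  have linP: "linear (P n)" and PP: "P n \<circ> P n = P n" if "n \<ge> 1" for n
    using P[OF that] by (auto simp: markov_projection_def markov_operator_def)
  have contr: "norm (?S n x) \<le> (1 - e) * norm x" if "n \<ge> 1" "P n x = 0" for n x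
  proof -
    have "markov_operator f (T n)" using T that by (auto simp: markov_sequences_def)
    then have "(1 - e) * norm (T n x) \<le> (1 - e) * norm x"
      using markov_operator_norm_le[OF A] e by (intro mult_left_mono) auto
    then show ?thesis using that e by (simp add: perturbed_def)
  qed
  fix m :: nat assume m: "0 < m"
  have Q: "linear (P (m + 1))" "P (m + 1) \<circ> P (m + 1) = P (m + 1)" "P (m + 1) \<noteq> id"
    using linP PP nontriv[of "m + 1"] m by auto
  have bl: "bounded_linear (ndmc ?S m n)" for n
    by (intro markov_operator_bounded_linear[OF A] markov_operator_ndmc mkS)
  have linS: "linear (?S n)" if "n \<ge> 1" for n
    using mkS[OF that] by (simp add: markov_operator_def)
  have le: "dobrushin (P (m + 1)) (ndmc ?S m (j + m)) \<le> (1 - e) ^ j" for j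
  proof -
    have "norm (ndmc ?S m (m + j) x) \<le> (1 - e) ^ j * norm x" if "P (Suc m) x = 0" for x
    proof (rule conjunct2[OF ndmc_contracts_kernel[of P ?S "1 - e" m x j]])
      show "0 \<le> 1 - e" using e by simp
    qed (fact linP linS ld comm contr that)+
    then show ?thesis
      using dobrushin_le_iff[OF Q bl, of "m + j" "(1 - e) ^ j"] by (simp add: add.commute)
  qed
  have "(\<lambda>j. dobrushin (P (m + 1)) (ndmc ?S m (j + m))) \<longlonglongrightarrow> 0"
  proof (rule tendsto_sandwich)
    show "\<forall>\<^sub>F j in sequentially. 0 \<le> dobrushin (P (m + 1)) (ndmc ?S m (j + m))"
      by (intro always_eventually allI dobrushin_nonneg[OF Q bl])
    show "\<forall>\<^sub>F j in sequentially. dobrushin (P (m + 1)) (ndmc ?S m (j + m)) \<le> (1 - e) ^ j"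
      by (intro always_eventually allI le)
    show "(\<lambda>j. (1 - e) ^ j) \<longlonglongrightarrow> 0" using e by (intro LIMSEQ_power_zero) auto
  qed simp
  then show "(\<lambda>n. dobrushin (P (m + 1)) (ndmc ?S m n)) \<longlonglongrightarrow> 0"
    by (rule LIMSEQ_offset)
qed

lemma seq_dist_perturbed_le:
  assumes A: "abstract_state_space f" and P: "\<And>n. n \<ge> 1 \<Longrightarrow> markov_projection f (P n)"
    and T: "T \<in> markov_sequences f P" and e: "0 \<le> e" "e \<le> 1"
  shows "seq_dist f P T (perturbed e P T) \<le> 2 * e"
proof (rule seq_dist_le[OF A T])
  show "perturbed e P T \<in> markov_sequences f P"
    by (rule perturbed_in_markov_sequences[OF A P T e])
next
  fix n :: nat assume n: "1 \<le> n"
  have mk: "markov_operator f (T n)" "markov_operator f (P n)"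
    using T P[OF n] n by (auto simp: markov_sequences_def markov_projection_def)
  have "(\<lambda>x. T n x - perturbed e P T n x) = (\<lambda>x. e *\<^sub>R (T n x - P n x))"
    using n by (simp add: perturbed_def fun_eq_iff algebra_simps)
  then have "onorm (\<lambda>x. T n x - perturbed e P T n x) = e * onorm (\<lambda>x. T n x - P n x)"
    using onorm_scaleR[OF bounded_linear_markov_diff[OF A mk], of e] e by simp
  also have "\<dots> \<le> 2 * e"
    using mult_left_mono[OF onorm_markov_diff_le[OF A mk] e(1)] by simp
  finally show "onorm (\<lambda>x. T n x - perturbed e P T n x) \<le> 2 * e" .
qed

section \<open>Weakly ergodic sequences are generic\<close>

theorem theorem7p2:
  fixes f :: "'a::{banach, ordered_real_vector} \<Rightarrow> real"
    and P :: "nat \<Rightarrow> 'a \<Rightarrow> 'a"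
  assumes "abstract_state_space f"
    and "\<forall>n\<ge>1. markov_projection f (P n)"
    and "left_decreasing P"
    and "\<forall>n\<ge>2. P n \<noteq> id"
  shows "seq_topology f P closure_of weakly_ergodic_sequences f P = markov_sequences f P
       \<and> gdelta_in (seq_topology f P) (weakly_ergodic_sequences f P)"
proof
  let ?M = "markov_sequences f P" and ?W = "weakly_ergodic_sequences f P"
  note A = assms(1) and ld = assms(3)
  have P: "markov_projection f (P n)" if "n \<ge> 1" for n using assms(2) that by simp
  have nontriv: "P n \<noteq> id" if "n \<ge> 2" for n using assms(4) that by simp
  have Q: "linear (P n) \<and> P n \<circ> P n = P n \<and> P n \<noteq> id" if "n \<ge> 2" for n
    using P[of n] nontriv[OF that] that by (simp add: markov_projection_def markov_operator_def)
  interpret Metric_space ?M "seq_dist f P" by (rule Metric_space_markov_sequences[OF A])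

  show "mtopology closure_of ?W = ?M"
  proof -
    have "\<exists>S\<in>?W. S \<in> mball T r" if T: "T \<in> ?M" and r: "r > 0" for T r
    proof -
      \<comment> \<open>The distance is at most \<open>2 e\<close>, so \<open>r / 3\<close> makes it strictly less than \<open>r\<close>;
        the cap at \<open>1\<close> keeps the combination convex.\<close>
      define e where "e = min 1 (r / 3)"
      have e: "0 < e" "0 \<le> e" "e \<le> 1" "2 * e < r" using r by (auto simp: e_def)
      have S: "perturbed e P T \<in> ?M" by (rule perturbed_in_markov_sequences[OF A P T e(2,3)])
      then have "perturbed e P T \<in> ?W"
        using weakly_ergodic_perturbed[OF A P ld nontriv T e(1,3)]
        by (simp add: weakly_ergodic_sequences_def)
      moreover have "perturbed e P T \<in> mball T r"
        using seq_dist_perturbed_le[OF A P T e(2,3)] e(4) T S by simp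
      ultimately show ?thesis by blast
    qed
    then show ?thesis unfolding metric_closure_of by blast
  qed

  \<comment> \<open>The condition \<open>m > 0\<close> is encoded by a successor, so that the index set is all of
    \<open>nat \<times> nat\<close>.\<close>
  define G where "G = (\<lambda>(m, k). \<Union>n. {T \<in> ?M.
    dobrushin (P (Suc m + 1)) (ndmc T (Suc m) n) < 1 / real (Suc k)})"
  have "T \<in> ?W \<longleftrightarrow> T \<in> \<Inter> (range G)" for T
  proof (cases "T \<in> ?M")
    case True
    then have mk: "markov_operator f (T n)" if "n \<ge> 1" for n
      using that by (simp add: markov_sequences_def)
    have "T \<in> ?W \<longleftrightarrow> (\<forall>m>0. \<forall>k. \<exists>n. dobrushin (P (m + 1)) (ndmc T m n) < 1 / real (Suc k))"
      using weakly_ergodic_iff_dobrushin_small[OF A mk Q] True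
      by (simp add: weakly_ergodic_sequences_def)
    also have "\<dots> \<longleftrightarrow> (\<forall>m k. \<exists>n. dobrushin (P (Suc m + 1)) (ndmc T (Suc m) n) < 1 / real (Suc k))"
      by (metis Suc_pred zero_less_Suc)
    also have "\<dots> \<longleftrightarrow> T \<in> \<Inter> (range G)" using True by (simp add: G_def)
    finally show ?thesis .
  next
    case False
    then show ?thesis by (simp add: G_def weakly_ergodic_sequences_def)
  qed
  then have "?W = \<Inter> (range G)" by blast
  moreover have "gdelta_in mtopology (G mk)" for mk
  proof (cases mk)
    case (Pair m k)
    have "openin mtopology {T \<in> ?M.
        dobrushin (P (Suc m + 1)) (ndmc T (Suc m) n) < 1 / real (Suc k)}" for n
      using Q[of "Suc m + 1"] by (intro openin_dobrushin_less[OF A]) auto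
    then show ?thesis
      unfolding Pair G_def by (auto intro!: open_imp_gdelta_in)
  qed
  ultimately show "gdelta_in mtopology ?W"
    by (auto intro!: gdelta_in_Inter)
qed

end
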